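(* There exists a positive integer $K_0$ such that for every integer $K\ge K_0$, $$\sum_{n\le K}\sigma(30n)>\sum_{n\le K}\sigma(30n+1),$$ where the sums are over positive integers $n\le K$.
   Context: $\sigma(n)=\sum_{d\mid n} d$ denotes the sum of the positive divisors of the positive integer $n$. *)

theory Defs
  imports Main
begin

(* At n = 0 every natural number divides n, so the sum ranges over an infinite set and is 0. *)
definition divisor_sigma :: "nat \<Rightarrow> nat" where
  "divisor_sigma n = (\<Sum>d | d dvd n. d)"

end

theory Submission
  imports Defs Complex_Main
begin

text \<open>
  The divisors \<open>30n/c\<close> with \<open>c\<close> dividing \<open>30\<close> give \<open>\<sigma>(30n) \<ge> 72n\<close>, so the left-hand sum is at
  least \<open>36K(K+1)\<close>. Put \<open>N = 30K + 1\<close>. Writing each divisor \<open>e\<close> of \<open>30n + 1\<close> together with its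
  codivisor \<open>d\<close>, the other sum is at most the sum over \<open>d \<le> N\<close> of all \<open>e \<le> N/d\<close> with
  \<open>de \<equiv> 1 (mod 30)\<close>. Such \<open>e\<close> lie in a single residue class modulo 30, so they sum to about
  \<open>(N/d)\<^sup>2/60\<close>. Since the series of \<open>1/d\<^sup>2\<close> is at most 2, this totals about \<open>N\<^sup>2/30 \<approx> 30K\<^sup>2\<close>, which
  leaves room for crude error terms.
\<close>

lemma divisor_sigma_30_ge:
  assumes "n \<ge> 1"
  shows "72 * n \<le> divisor_sigma (30 * n)"
proof -
  let ?S = "{30 * n, 15 * n, 10 * n, 6 * n, 5 * n, 3 * n, 2 * n, n}"
  \<comment> \<open>Here 72 is the divisor sum of 30; \<open>n \<ge> 1\<close> keeps the eight
    elements distinct.\<close>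
  have "72 * n = \<Sum> ?S"
    using assms by simp
  also have "\<dots> \<le> (\<Sum>d | d dvd 30 * n. d)"
    using assms by (intro sum_mono2) (auto intro: mult_dvd_mono)
  finally show ?thesis
    by (simp add: divisor_sigma_def)
qed

lemma sum_inverse_squares_le:
  "(\<Sum>d = 1..N. 1 / (real d)\<^sup>2) \<le> 2"
proof -
  \<comment> \<open>The subtracted term makes the induction telescope.\<close>
  have "(\<Sum>d = 1..Suc m. 1 / (real d)\<^sup>2) \<le> 2 - 1 / real (Suc m)" for m
  proof (induction m)
    case (Suc m)
    have "1 / (real (Suc (Suc m)))\<^sup>2 \<le> 1 / (real (Suc m) * real (Suc (Suc m)))"
      unfolding power2_eq_square by (intro divide_left_mono mult_right_mono) auto
    also have "\<dots> = 1 / real (Suc m) - 1 / real (Suc (Suc m))"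
      by (simp add: field_simps)
    finally show ?case
      using Suc by simp
  qed simp
  from this[of "N - 1"] show ?thesis
    by (cases N) (auto intro: order_trans)
qed

lemma sum_arith_progression:
  "2 * (\<Sum>k\<le>q. r + m * k) = (q + 1) * (2 * r + m * (q :: nat))"
  by (induction q) (auto simp: algebra_simps)

text \<open>
  The coefficient is weakened from \<open>15\<close> to \<open>33/2\<close> so that the linear terms in \<open>M\<close> are absorbed
  and no harmonic sum arises when \<open>M = N div d\<close> is summed over \<open>d\<close>.
\<close>
lemma sum_residue_class_le:
  fixes M r :: nat
  assumes "r < 30"
  shows "real (\<Sum>e | e \<le> M \<and> e mod 30 = r. e) \<le> 33 / 2 * (real M / 30)\<^sup>2 + 352"
proof -
  define q where "q = M div 30"
  \<comment> \<open>The term for \<open>k = q\<close> may exceed \<open>M\<close>, so this is only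
    an inclusion, enough for an upper bound.\<close>
  have "{e. e \<le> M \<and> e mod 30 = r} \<subseteq> (\<lambda>k. r + 30 * k) ` {..q}"
  proof
    fix e assume e: "e \<in> {e. e \<le> M \<and> e mod 30 = r}"
    then have "e = r + 30 * (e div 30)" "e div 30 \<le> q"
      by (auto simp: q_def div_le_mono)
    then show "e \<in> (\<lambda>k. r + 30 * k) ` {..q}"
      by blast
  qed
  then have "(\<Sum>e | e \<le> M \<and> e mod 30 = r. e) \<le> \<Sum> ((\<lambda>k. r + 30 * k) ` {..q})"
    by (intro sum_mono2) auto
  also have "\<dots> = (\<Sum>k\<le>q. r + 30 * k)"
    by (subst sum.reindex) (auto simp: inj_on_def)
  finally have "2 * (\<Sum>e | e \<le> M \<and> e mod 30 = r. e) \<le> (q + 1) * (2 * r + 30 * q)"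
    using sum_arith_progression[of r 30 q] by linarith
  also have "\<dots> \<le> (q + 1) * (58 + 30 * q)"
    using assms by (intro mult_left_mono) auto
  finally have "2 * (\<Sum>e | e \<le> M \<and> e mod 30 = r. e) \<le> (q + 1) * (58 + 30 * q)" .
  then have "2 * real (\<Sum>e | e \<le> M \<and> e mod 30 = r. e) \<le> (real q + 1) * (58 + 30 * real q)"
    unfolding of_nat_le_iff[where 'a = real, symmetric] by (simp add: algebra_simps)
  \<comment> \<open>Completing the square: three times the difference of the two sides is
    \<open>(3 * q - 44)^2 + 2\<close>.\<close>
  also have "\<dots> \<le> 33 * (real q)\<^sup>2 + 704"
    using zero_le_power2[of "3 * real q - 44"] by (simp add: power2_eq_square algebra_simps)
  also have "\<dots> \<le> 33 * (real M / 30)\<^sup>2 + 704"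
  proof -
    have "real q \<le> real M / 30"
      unfolding q_def using of_nat_div_le_of_nat[of M 30, where 'a = real] by simp
    then show ?thesis
      by (simp add: power_mono)
  qed
  finally show ?thesis
    by simp
qed

text \<open>Inverses modulo 30 are unique: if \<open>e\<close> and \<open>e0\<close> both invert
  \<open>d\<close>, then e = e(d e0) = e0(d e) = e0 modulo 30. If \<open>d\<close> has no inverse,
  the sum is empty.\<close>

lemma sum_inverse_class_le:
  fixes M d :: nat
  shows "real (\<Sum>e | e \<le> M \<and> d * e mod 30 = 1. e) \<le> 33 / 2 * (real M / 30)\<^sup>2 + 352"
proof (cases "\<exists>e0. d * e0 mod 30 = 1")
  case True
  then obtain e0 where e0: "d * e0 mod 30 = 1" ..
  have "e mod 30 = e0 mod 30" if "d * e mod 30 = 1" for e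
  proof -
    have "e mod 30 = e * (d * e0) mod 30"
      using e0 by (metis mod_mult_right_eq mult_1_right)
    also have "\<dots> = e0 * (d * e) mod 30"
      by (simp add: ac_simps)
    also have "\<dots> = e0 mod 30"
      using that by (metis mod_mult_right_eq mult_1_right)
    finally show ?thesis .
  qed
  then have "(\<Sum>e | e \<le> M \<and> d * e mod 30 = 1. e) \<le> (\<Sum>e | e \<le> M \<and> e mod 30 = e0 mod 30. e)"
    by (intro sum_mono2) auto
  then have "real (\<Sum>e | e \<le> M \<and> d * e mod 30 = 1. e)
      \<le> real (\<Sum>e | e \<le> M \<and> e mod 30 = e0 mod 30. e)"
    by (simp only: of_nat_le_iff)
  also have "\<dots> \<le> 33 / 2 * (real M / 30)\<^sup>2 + 352"
    by (rule sum_residue_class_le) simp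
  finally show ?thesis .
next
  case False
  then have "{e. e \<le> M \<and> d * e mod 30 = 1} = {}"
    by auto
  then show ?thesis
    by (simp only: sum.empty) simp
qed

lemma sum_divisor_sigma_le_codivisors:
  "(\<Sum>n = 1..K. divisor_sigma (30 * n + 1))
    \<le> (\<Sum>d = 1..30 * K + 1. \<Sum>e | e \<le> (30 * K + 1) div d \<and> d * e mod 30 = 1. e)"
proof -
  define N where "N = 30 * K + 1"
  define P where "P = (SIGMA n:{1..K}. {e. e dvd 30 * n + 1})"
  define Q where "Q = (SIGMA d:{1..N}. {e. e \<le> N div d \<and> d * e mod 30 = 1})"
  define f where "f = (\<lambda>(n, e :: nat). ((30 * n + 1) div e, e))"
  have "(\<Sum>n = 1..K. divisor_sigma (30 * n + 1)) = (\<Sum>(n, e)\<in>P. e)"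
    unfolding divisor_sigma_def P_def by (rule sum.Sigma) auto
  also have "\<dots> = (\<Sum>x\<in>P. snd (f x))"
    by (auto simp: f_def intro!: sum.cong)
  also have "\<dots> = (\<Sum>y\<in>f ` P. snd y)"
  proof -
    \<comment> \<open>The map keeps \<open>e\<close>, and the product of its two components is
      \<open>30 * n + 1\<close>, which recovers \<open>n\<close>.\<close>
    have "inj_on f P"
      by (rule inj_onI) (auto simp: f_def P_def dvd_div_eq_iff)
    then show ?thesis
      by (simp add: sum.reindex)
  qed
  also have "\<dots> \<le> (\<Sum>y\<in>Q. snd y)"
  proof (rule sum_mono2)
    show "f ` P \<subseteq> Q"
    proof (clarsimp simp: f_def P_def)
      fix n e assume n: "Suc 0 \<le> n" "n \<le> K" and "e dvd Suc (30 * n)"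
      then obtain d where d: "Suc (30 * n) = e * d"
        by blast
      then have pos: "e > 0" "d > 0"
        by (auto intro: Nat.gr0I)
      have "d * e \<le> N"
        using d n by (simp add: N_def mult.commute)
      moreover from this have "d \<le> N"
        using pos by (metis dvd_imp_le dvd_triv_left le_trans mult_pos_pos)
      moreover have "d * e mod 30 = 1"
        unfolding mult.commute[of d e] d[symmetric] by presburger
      ultimately show "(Suc (30 * n) div e, e) \<in> Q"
        using d pos by (simp add: Q_def less_eq_div_iff_mult_less_eq mult.commute)
    qed
  qed (auto simp: Q_def)
  also have "\<dots> = (\<Sum>d = 1..N. \<Sum>e | e \<le> N div d \<and> d * e mod 30 = 1. e)"
    unfolding Q_def by (subst sum.Sigma) (auto intro!: sum.cong)
  finally show ?thesis
    by (simp only: N_def)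
qed

text \<open>The inverse squares at most double \<open>33 / 2\<close>, giving 33, which is below the
  36 of the lower bound. The constant 352 is paid once per \<open>d\<close>, so the error is only
  linear in \<open>N\<close>.\<close>

lemma sum_divisor_sigma_30_plus_1_le:
  fixes K :: nat
  defines "N \<equiv> 30 * real K + 1"
  shows "real (\<Sum>n = 1..K. divisor_sigma (30 * n + 1)) \<le> 33 * (N / 30)\<^sup>2 + 352 * N"
proof -
  define L where "L = 30 * K + 1"
  have N: "N = real L"
    by (simp add: N_def L_def)
  have "real (\<Sum>n = 1..K. divisor_sigma (30 * n + 1))
      \<le> real (\<Sum>d = 1..L. \<Sum>e | e \<le> L div d \<and> d * e mod 30 = 1. e)"
    using sum_divisor_sigma_le_codivisors[of K] by (simp only: L_def of_nat_le_iff)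
  also have "\<dots> = (\<Sum>d = 1..L. real (\<Sum>e | e \<le> L div d \<and> d * e mod 30 = 1. e))"
    by (rule of_nat_sum)
  also have "\<dots> \<le> (\<Sum>d = 1..L. 33 / 2 * (N / 30)\<^sup>2 * (1 / (real d)\<^sup>2) + 352)"
  proof (rule sum_mono)
    fix d assume "d \<in> {1..L}"
    have "(real (L div d) / 30)\<^sup>2 \<le> (N / real d / 30)\<^sup>2"
      using of_nat_div_le_of_nat[of L d, where 'a = real] by (intro power_mono divide_right_mono) (auto simp: N)
    also have "\<dots> = (N / 30)\<^sup>2 * (1 / (real d)\<^sup>2)"
      by (simp add: power_divide)
    finally show "real (\<Sum>e | e \<le> L div d \<and> d * e mod 30 = 1. e)
        \<le> 33 / 2 * (N / 30)\<^sup>2 * (1 / (real d)\<^sup>2) + 352"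
      using sum_inverse_class_le[of "L div d" d] by linarith
  qed
  also have "\<dots> = 33 / 2 * (N / 30)\<^sup>2 * (\<Sum>d = 1..L. 1 / (real d)\<^sup>2) + 352 * N"
    by (simp only: sum.distrib flip: sum_distrib_left) (simp add: N)
  also have "\<dots> \<le> 33 / 2 * (N / 30)\<^sup>2 * 2 + 352 * N"
    using sum_inverse_squares_le[of L] by (intro add_right_mono mult_left_mono) auto
  finally show ?thesis
    by simp
qed

lemma sum_divisor_sigma_30_ge:
  "36 * K * (K + 1) \<le> (\<Sum>n = 1..K. divisor_sigma (30 * n))"
proof -
  have "36 * K * (K + 1) = (\<Sum>n = 1..K. 72 * n)"
    by (induction K) (auto simp: algebra_simps)
  also have "\<dots> \<le> (\<Sum>n = 1..K. divisor_sigma (30 * n))"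
    by (intro sum_mono divisor_sigma_30_ge) simp
  finally show ?thesis .
qed

theorem theorem2:
  shows "\<exists>K\<^sub>0 :: nat. K\<^sub>0 > 0 \<and>
    (\<forall>K \<ge> K\<^sub>0. (\<Sum>n = 1..K. divisor_sigma (30 * n)) > (\<Sum>n = 1..K. divisor_sigma (30 * n + 1)))"
\<comment> \<open>The gap \<open>3 * K^2\<close> must beat a linear term of about
  \<open>10526 * K\<close>, which happens from roughly 3509 on; 4000 is a round choice.\<close>
proof (intro exI[of _ 4000] conjI allI impI)
  fix K :: nat assume K: "4000 \<le> K"
  have "real (\<Sum>n = 1..K. divisor_sigma (30 * n + 1))
      \<le> 33 * ((30 * real K + 1) / 30)\<^sup>2 + 352 * (30 * real K + 1)"
    by (rule sum_divisor_sigma_30_plus_1_le)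
  also have "\<dots> < 36 * real K * (real K + 1)"
  proof -
    have "33 * ((30 * real K + 1) / 30)\<^sup>2 + 352 * (30 * real K + 1)
        = 33 * (real K * real K) + 52811 / 5 * real K + 105611 / 300"
      by (simp add: power2_eq_square field_simps)
    also have "\<dots> < 36 * (real K * real K) + 36 * real K"
    proof -
      have "4000 * real K \<le> real K * real K" "4000 \<le> real K"
        using K by (auto intro: mult_right_mono)
      then show ?thesis
        by linarith
    qed
    also have "\<dots> = 36 * real K * (real K + 1)"
      by (simp add: algebra_simps)
    finally show ?thesis .
  qed
  also have "\<dots> = real (36 * K * (K + 1))"
    by (simp add: algebra_simps)
  also have "\<dots> \<le> real (\<Sum>n = 1..K. divisor_sigma (30 * n))"
    using sum_divisor_sigma_30_ge by (simp only: of_nat_le_iff)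
  finally show "(\<Sum>n = 1..K. divisor_sigma (30 * n + 1)) < (\<Sum>n = 1..K. divisor_sigma (30 * n))"
    by (simp only: of_nat_less_iff)
qed simp

end
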